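(* Let $k\ge 1$ and $r\geq 1$ be integers. The generating function of the $r$-times iterated binomial transform $\{b_{k,n}^{(r)}\}_{n\ge 0}$ of the $k$-Lucas sequence $\{L_{k,n}\}$ is $$\sum_{i=0}^{\infty}b_{k,i}^{(r)}x^{i}=\frac{2-(2r+k)x}{1-(2r+k)x+(r^{2}+kr-1)x^{2}}.$$
   Context: The $k$-Lucas sequence $\{L_{k,n}\}_{n\ge 0}$ is defined by $L_{k,0}=2$, $L_{k,1}=k$ and $L_{k,n+1}=kL_{k,n}+L_{k,n-1}$ for $n\ge 1$. The binomial transform of a sequence $\{x_0,x_1,x_2,\ldots\}$ is the sequence $\{b_n\}$ with $b_n=\sum_{i=0}^{n}\binom{n}{i}x_i$. The sequence $\{b_{k,n}^{(r)}\}_{n\ge 0}$ is obtained by applying the binomial transform $r$ times to the $k$-Lucas sequence, i.e. $b_{k,n}^{(0)}=L_{k,n}$ and $b_{k,n}^{(r)}=\sum_{i=0}^{n}\binom{n}{i}b_{k,i}^{(r-1)}$ for $r\ge 1$. The generating function identity is an identity of formal power series in $x$. *)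

theory Defs
  imports Complex_Main "HOL-Computational_Algebra.Formal_Power_Series"
begin

fun k_lucas :: "nat \<Rightarrow> nat \<Rightarrow> int" where
  "k_lucas k 0 = 2"
| "k_lucas k (Suc 0) = int k"
| "k_lucas k (Suc (Suc n)) = int k * k_lucas k (Suc n) + k_lucas k n"

definition binomial_transform :: "(nat \<Rightarrow> int) \<Rightarrow> nat \<Rightarrow> int" where
  "binomial_transform x n = (\<Sum>i=0..n. int (n choose i) * x i)"

definition iterated_binomial_k_lucas :: "nat \<Rightarrow> nat \<Rightarrow> nat \<Rightarrow> int" where
  "iterated_binomial_k_lucas k r = (binomial_transform ^^ r) (k_lucas k)"

end

theory Submission
  imports Defs
begin

text \<open>
  Write \<open>E\<close> for the shift \<open>x\<^sub>n \<mapsto> x\<^sub>n\<^sub>+\<^sub>1\<close> and \<open>B\<close> for the binomial transform. Pascal's rule is the operator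
  identity \<open>E B = B (1 + E)\<close> (lemma \<open>binomial_transform_Suc\<close>), that is, \<open>(E - 1) B = B E\<close>. So if
  \<open>E\<^sup>2 x = p E x - q x\<close>, then \<open>(E - 1)\<^sup>2 B x = p (E - 1) B x - q B x\<close>: the transform satisfies a
  recurrence of the same kind, with both roots of the characteristic polynomial increased by 1
  (lemma \<open>binomial_transform_recurrence\<close>). The \<open>k\<close>-Lucas sequence has characteristic polynomial
  \<open>t\<^sup>2 - k t - 1\<close>, so after \<open>r\<close> transforms it is \<open>(t - r)\<^sup>2 - k (t - r) - 1\<close>, whose coefficients are
  those of the stated denominator. The numerator is then determined by the first two terms,
  \<open>2\<close> and \<open>2 r + k\<close>.
\<close>

lemma binomial_transform_0: "binomial_transform x 0 = x 0"
  by (simp add: binomial_transform_def)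

text \<open>
  Pascal's rule splits every coefficient of the sum except the one at \<open>0\<close>. The part with
  \<open>n choose (i + 1)\<close> has a vanishing term at \<open>i = n\<close> and, together with \<open>x\<^sub>0\<close>, gives the transform
  of \<open>x\<close> at \<open>n\<close>; the other part is the transform of the shifted sequence.
\<close>

lemma binomial_transform_Suc:
  "binomial_transform x (Suc n) = binomial_transform x n + binomial_transform (\<lambda>i. x (Suc i)) n"
proof -
  have "binomial_transform x (Suc n) = x 0 + (\<Sum>i\<le>n. int (Suc n choose Suc i) * x (Suc i))"
    unfolding binomial_transform_def atLeast0AtMost by (subst sum.atMost_Suc_shift) simp
  also have "\<dots> = (x 0 + (\<Sum>i\<le>n. int (n choose Suc i) * x (Suc i)))
      + (\<Sum>i\<le>n. int (n choose i) * x (Suc i))"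
    by (simp add: sum.distrib algebra_simps)
  also have "x 0 + (\<Sum>i\<le>n. int (n choose Suc i) * x (Suc i)) = (\<Sum>i\<le>Suc n. int (n choose i) * x i)"
    by (subst sum.atMost_Suc_shift) simp
  also have "\<dots> = (\<Sum>i\<le>n. int (n choose i) * x i)"
    by simp
  finally show ?thesis
    by (simp add: binomial_transform_def atLeast0AtMost)
qed

lemma binomial_transform_linear_combination:
  "binomial_transform (\<lambda>i. a * x i + b * y i) n
     = a * binomial_transform x n + b * binomial_transform y n"
  by (simp add: binomial_transform_def sum_distrib_left sum.distrib algebra_simps)

text \<open>
  The new coefficients are those of \<open>(t - 1)\<^sup>2 - p (t - 1) + q\<close>: expressing \<open>B E\<close> as \<open>(E - 1) B\<close>
  replaces \<open>t\<close> by \<open>t - 1\<close> in the characteristic polynomial \<open>t\<^sup>2 - p t + q\<close>.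
\<close>

lemma binomial_transform_recurrence:
  assumes rec: "\<And>n. x (Suc (Suc n)) = p * x (Suc n) - q * x n"
  shows "binomial_transform x (Suc (Suc n))
           = (p + 2) * binomial_transform x (Suc n) - (q + p + 1) * binomial_transform x n"
proof -
  let ?B = "\<lambda>x. binomial_transform x n"
  have "?B (\<lambda>i. x (Suc (Suc i))) = p * ?B (\<lambda>i. x (Suc i)) - q * ?B x"
    using binomial_transform_linear_combination[of p "\<lambda>i. x (Suc i)" "- q" x n]
    by (simp add: rec)
  then show ?thesis
    by (simp add: binomial_transform_Suc algebra_simps)
qed

lemma iterated_binomial_k_lucas_Suc:
  "iterated_binomial_k_lucas k (Suc r) = binomial_transform (iterated_binomial_k_lucas k r)"
  by (simp add: iterated_binomial_k_lucas_def)

lemma iterated_binomial_k_lucas_initial: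
  "iterated_binomial_k_lucas k r 0 = 2"
  "iterated_binomial_k_lucas k r (Suc 0) = 2 * int r + int k"
proof (induction r)
  case 0
  show "iterated_binomial_k_lucas k 0 0 = 2"
    and "iterated_binomial_k_lucas k 0 (Suc 0) = 2 * int 0 + int k"
    by (simp_all add: iterated_binomial_k_lucas_def)
next
  case (Suc r)
  then show "iterated_binomial_k_lucas k (Suc r) 0 = 2"
    and "iterated_binomial_k_lucas k (Suc r) (Suc 0) = 2 * int (Suc r) + int k"
    by (simp_all add: iterated_binomial_k_lucas_Suc binomial_transform_0 binomial_transform_Suc)
qed

lemma iterated_binomial_k_lucas_recurrence:
  "iterated_binomial_k_lucas k r (Suc (Suc n))
     = (2 * int r + int k) * iterated_binomial_k_lucas k r (Suc n)
       - ((int r)\<^sup>2 + int k * int r - 1) * iterated_binomial_k_lucas k r n"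
proof (induction r arbitrary: n)
  case 0
  show ?case
    by (simp add: iterated_binomial_k_lucas_def)
next
  case (Suc r)
  show ?case
    unfolding iterated_binomial_k_lucas_Suc
      binomial_transform_recurrence[of "iterated_binomial_k_lucas k r", OF Suc.IH]
    by (simp add: algebra_simps power2_eq_square)
qed

text \<open>
  Multiplying the series by \<open>1 - p X + q X\<^sup>2\<close> makes every coefficient from degree 2 on vanish by the
  recurrence, and this factor can be divided out because its constant term is nonzero.
\<close>

lemma fps_of_linear_recurrence_2:
  fixes a :: "nat \<Rightarrow> 'a :: field"
  assumes rec: "\<And>n. a (Suc (Suc n)) = p * a (Suc n) - q * a n"
  shows "Abs_fps a = (fps_const (a 0) + fps_const (a 1 - p * a 0) * fps_X) /
           (1 - fps_const p * fps_X + fps_const q * fps_X\<^sup>2)"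
    (is "_ = ?N / ?D")
proof -
  have "fps_nth ?D 0 \<noteq> 0"
    by (simp add: power2_eq_square)
  then have "?D \<noteq> 0"
    by (metis fps_zero_nth)
  have "Abs_fps a * ?D
      = Abs_fps a - fps_const p * (fps_X * Abs_fps a) + fps_const q * (fps_X * (fps_X * Abs_fps a))"
    by (simp add: algebra_simps power2_eq_square)
  also have "\<dots> = ?N"
  proof (rule fps_ext)
    fix n
    consider "n = 0" | "n = 1" | m where "n = Suc (Suc m)"
      by (metis One_nat_def not0_implies_Suc)
    then show "fps_nth (Abs_fps a - fps_const p * (fps_X * Abs_fps a)
        + fps_const q * (fps_X * (fps_X * Abs_fps a))) n = fps_nth ?N n"
      by cases (simp_all add: rec)
  qed
  finally have "?N = Abs_fps a * ?D"
    by simp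
  with \<open>?D \<noteq> 0\<close> show ?thesis
    by simp
qed

theorem theorem2p3:
  fixes k r :: nat
  assumes "k \<ge> 1" and "r \<ge> 1"
  shows "Abs_fps (\<lambda>i. real_of_int (iterated_binomial_k_lucas k r i)) =
    (fps_const 2 - fps_const (2 * real r + real k) * fps_X) /
    (1 - fps_const (2 * real r + real k) * fps_X
       + fps_const ((real r)\<^sup>2 + real k * real r - 1) * fps_X\<^sup>2)"
proof -
  define a where "a = (\<lambda>i. real_of_int (iterated_binomial_k_lucas k r i))"
  define p where "p = 2 * real r + real k"
  define q where "q = (real r)\<^sup>2 + real k * real r - 1"
  have rec: "a (Suc (Suc n)) = p * a (Suc n) - q * a n" for n
    by (simp add: a_def p_def q_def iterated_binomial_k_lucas_recurrence)
  have "a 0 = 2" and "a 1 - p * a 0 = - p"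
    by (simp_all add: a_def p_def iterated_binomial_k_lucas_initial)
  then have "Abs_fps a = (fps_const 2 + fps_const (- p) * fps_X) /
      (1 - fps_const p * fps_X + fps_const q * fps_X\<^sup>2)"
    using fps_of_linear_recurrence_2[of a p q, OF rec] by simp
  also have "fps_const 2 + fps_const (- p) * fps_X = fps_const 2 - fps_const p * fps_X"
    by (simp flip: fps_const_neg)
  finally show ?thesis
    by (simp only: a_def p_def q_def)
qed

end
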